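(* Let $(X,\Sigma,\mu)$ be a $\sigma$-finite nonatomic measure space (with $\mu(X)=\infty$). Let $S$ be a finite collection of real-valued measurable functions on $X$ such that $f-1\in L^1(X,\Sigma,\mu)$ for all $f\in S$ and $$\int_X (f-1)\,d\mu=0\qquad\text{for all } f\in S.$$ Then there exists a common segment for all $\mu_f$, $f\in S$; that is, there exists a family $u(t)\in\Sigma$, $t\in[0,\infty)$, such that $u(0)=\emptyset$, $u(s)\subseteq u(t)$ whenever $s<t$, $\bigcup_{t\ge 0}u(t)=X$, and for every $f\in S$ and every $t\ge 0$ the integral $\mu_f(u(t))=\int_{u(t)} f\,d\mu$ is defined and equals $t$.
   Context: Measures are nonnegative. A measure space $(X,\Sigma,\mu)$ is nonatomic if for every $A\in\Sigma$ with $\mu(A)>0$ there exists $B\in\Sigma$, $B\subseteq A$, with $0<\mu(B)<\mu(A)$. Here a $\sigma$-finite measure space means a measure space with $\mu(X)=\infty$ and $X=\bigcup_i X_i$ for countably many $X_i\in\Sigma$ with $\mu(X_i)<\infty$. For a function $f$ with $f-1\in L^1(X,\Sigma,\mu)$, $\mu_f(E)=\int_E f\,d\mu$ for those $E\in\Sigma$ for which this integral is defined (in particular whenever $\mu(E)<\infty$). *)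

theory Defs
  imports "HOL-Analysis.Analysis"
begin

definition nonatomic :: "'a measure \<Rightarrow> bool" where
  "nonatomic M \<longleftrightarrow>
    (\<forall>A\<in>sets M. emeasure M A > 0 \<longrightarrow>
      (\<exists>B\<in>sets M. B \<subseteq> A \<and> 0 < emeasure M B \<and> emeasure M B < emeasure M A))"

(* The measure mu_f is E |-> (LINT x:E|M. f x) on the sets E where the integral is defined.
   The values required below are finite, so "the integral over u t is defined and equals t"
   is integrability of f on u t together with the equation; the equation alone would not
   do, since the integral of a non-integrable function is 0 by convention.
   Only the values u t with t >= 0 are relevant. *)

definition common_segment :: "'a measure \<Rightarrow> ('a \<Rightarrow> real) set \<Rightarrow> (real \<Rightarrow> 'a set) \<Rightarrow> bool" where
  "common_segment M S u \<longleftrightarrow>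
    (\<forall>t\<ge>0. u t \<in> sets M) \<and>
    u 0 = {} \<and>
    (\<forall>s t. 0 \<le> s \<and> s < t \<longrightarrow> u s \<subseteq> u t) \<and>
    (\<Union>t\<in>{0..}. u t) = space M \<and>
    (\<forall>f\<in>S. \<forall>t\<ge>0. set_integrable M (u t) f \<and> (LINT x:u t|M. f x) = t)"

end

theory Submission
  imports Defs
begin

text \<open>The segment is the family of sublevel sets of a real function \<open>\<sigma>\<close> on \<open>X\<close> whose
  distribution \<open>N\<close> is a diffuse measure on the half-line, finite on bounded sets, and such that
  \<open>f - 1\<close> integrates to zero over every \<open>\<sigma>\<close>-measurable set; then
  \<open>u(t) = {F \<circ> \<sigma> < t}\<close> with \<open>F x = N(-\<infinity>, x)\<close>. The functions \<open>g = f - 1\<close> are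
  treated one at a time. The distribution of \<open>\<sigma>\<close> weighted by \<open>g\<close> has a density \<open>h\<close> with respect
  to \<open>N\<close>, so the next function can be handled on the line, by composing \<open>\<sigma>\<close> with a map \<open>r\<close>; this
  does not disturb the functions already treated. As \<open>h\<close> has integral zero, its positive and
  negative parts have equal mass, and \<open>r\<close> matches the points of \<open>{h > 0}\<close> and \<open>{h < 0}\<close> having
  the same amount of that mass to their left. No form of the Lyapunov convexity theorem is needed.
  Nonatomicity only enters for the initial \<open>\<sigma>\<close>.\<close>

section \<open>Diffuse measures on the half-line\<close>

text \<open>Total mass may be finite or infinite: instances are distributions of coordinates on X
  and the two parts of an integrable density. Absence of atoms makes \<open>F\<close> continuous,
  finite half-lines make it real-valued, and the last axiom makes it vanish at 0.\<close>

locale diffuse_half_line =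
  fixes D :: "real measure"
  assumes sets_eq_borel [simp, measurable_cong]: "sets D = sets borel"
    and emeasure_singleton: "emeasure D {z} = 0"
    and emeasure_lessThan_finite: "emeasure D {..<z} < \<infinity>"
    and emeasure_negative: "emeasure D {..<0} = 0"
begin

lemma space_eq_UNIV [simp]: "space D = UNIV"
  using sets_eq_imp_space_eq[OF sets_eq_borel] by simp

definition F :: "real \<Rightarrow> real" where
  "F x = measure D {..<x}"

lemma emeasure_lessThan: "emeasure D {..<x} = ennreal (F x)"
  unfolding F_def using emeasure_lessThan_finite[of x] by (simp add: emeasure_eq_ennreal_measure)

lemma F_mono: "x \<le> y \<Longrightarrow> F x \<le> F y"
  unfolding F_def using emeasure_lessThan_finite[of y]
  by (intro measure_mono_fmeasurable) (auto simp: fmeasurable_def)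

lemma F_nonneg [simp]: "0 \<le> F x"
  by (simp add: F_def)

lemma F_not_negative [simp]: "\<not> F x < 0"
  by (simp add: not_less)

lemma F_measurable [measurable]: "F \<in> borel_measurable borel"
  by (intro borel_measurable_mono monoI F_mono)

lemma F_unbounded:
  assumes "ennreal t < emeasure D UNIV"
  shows "\<exists>z. t \<le> F z"
proof (rule ccontr)
  assume "\<not> ?thesis"
  then have le: "emeasure D {..<real n} \<le> ennreal t" for n :: nat
    unfolding emeasure_lessThan by (intro ennreal_leI) (simp add: not_le less_imp_le)
  have "(\<Union>n. {..<real n}) = UNIV"
    using reals_Archimedean2 by auto
  moreover have "(SUP n. emeasure D {..<real n}) = emeasure D (\<Union>n. {..<real n})"
    by (rule SUP_emeasure_incseq) (auto simp: incseq_def)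
  ultimately have "emeasure D UNIV = (SUP n. emeasure D {..<real n})"
    by simp
  also have "\<dots> \<le> ennreal t"
    using le by (intro SUP_least)
  finally show False
    using assms by simp
qed

text \<open>\<open>F\<close> carries \<open>D\<close> to Lebesgue measure on an interval: being
  continuous, it takes the value \<open>t\<close> at a suitable \<open>z\<close>, and the sublevel
  set is the half-line \<open>{..<z}\<close>.\<close>

lemma emeasure_F_less:
  assumes t: "0 \<le> t" "ennreal t < emeasure D UNIV"
  shows "emeasure D {x. F x < t} = ennreal t"
proof (cases "t = 0")
  case True
  then show ?thesis
    by (simp add: not_less)
next
  case False
  define K where "K = {z. F z < t}"
  have F0: "F 0 = 0"
    using emeasure_negative emeasure_lessThan[of 0] by (simp add: ennreal_eq_0_iff antisym)
  obtain w where w: "t \<le> F w"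
    using F_unbounded[OF t(2)] by blast
  have upper: "z \<le> w" if "z \<in> K" for z
    using that w F_mono[of w z] by (force simp: K_def not_le[symmetric])
  then have bdd: "bdd_above K"
    by (auto simp: bdd_above_def)
  have "0 \<in> K"
    using F0 False t by (simp add: K_def)
  define z where "z = Sup K"
  have below: "F x < t" if x: "x < z" for x
  proof -
    obtain k where "k \<in> K" "x < k"
      using less_cSupD[of K x] x \<open>0 \<in> K\<close> by (auto simp: z_def)
    then show ?thesis
      using F_mono[of x k] by (simp add: K_def)
  qed
  have above: "t \<le> F x" if "z < x" for x
    using cSup_upper[OF _ bdd, of x] that by (force simp: z_def K_def)
  \<comment> \<open>From the left: half-lines ending before \<open>z\<close> have mass below
    \<open>t\<close>, so their union has mass at most \<open>t\<close>.\<close>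
  have "emeasure D {..<z} = emeasure D (\<Union>n. {..<z - 1 / real (Suc n)})"
  proof (rule arg_cong[where f = "emeasure D"])
    have "x \<in> (\<Union>n. {..<z - 1 / real (Suc n)})" if x: "x < z" for x
    proof -
      obtain n where "inverse (real (Suc n)) < z - x"
        using reals_Archimedean[of "z - x"] x by auto
      then show ?thesis
        by (intro UN_I[of n]) (auto simp: field_simps)
    qed
    moreover have "x < z" if "x < z - 1 / real (Suc n)" for x n
      using that by (smt (verit) divide_pos_pos of_nat_0_less_iff zero_less_Suc)
    ultimately show "{..<z} = (\<Union>n. {..<z - 1 / real (Suc n)})"
      by auto
  qed
  also have "\<dots> = (SUP n. emeasure D {..<z - 1 / real (Suc n)})"
    by (rule SUP_emeasure_incseq[symmetric]) (auto simp: incseq_def frac_le intro: order_less_le_trans)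
  also have "\<dots> \<le> ennreal t"
    unfolding emeasure_lessThan using below by (intro SUP_least ennreal_leI less_imp_le) auto
  finally have le: "emeasure D {..<z} \<le> ennreal t" .
  \<comment> \<open>From the right: finiteness permits continuity from above, the limit is
    \<open>{..z}\<close>, and dropping the null point \<open>z\<close> gives the reverse
    bound.\<close>
  have "ennreal t \<le> (INF n. emeasure D {..<z + 1 / real (Suc n)})"
    unfolding emeasure_lessThan using above by (intro INF_greatest ennreal_leI) auto
  also have "\<dots> = emeasure D (\<Inter>n. {..<z + 1 / real (Suc n)})"
    using emeasure_lessThan_finite
    by (intro INF_emeasure_decseq)
      (auto simp: decseq_def frac_le less_top[symmetric] intro: order_less_le_trans)
  also have "(\<Inter>n. {..<z + 1 / real (Suc n)}) = {..z}"
  proof -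
    have "x \<le> z" if "\<forall>n. x < z + 1 / real (Suc n)" for x
    proof (rule ccontr)
      assume "\<not> x \<le> z"
      then obtain n where "inverse (real (Suc n)) < x - z"
        using reals_Archimedean[of "x - z"] by auto
      with that[rule_format, of n] show False
        by (auto simp: field_simps)
    qed
    moreover have "x < z + 1 / real (Suc n)" if "x \<le> z" for x n
      using that by (smt (verit) divide_pos_pos of_nat_0_less_iff zero_less_Suc)
    ultimately show ?thesis
      by auto
  qed
  also have "{..z} = {..<z} \<union> {z}"
    by auto
  also have "emeasure D \<dots> = emeasure D {..<z} + emeasure D {z}"
    by (rule plus_emeasure[symmetric]) auto
  finally have "ennreal t \<le> emeasure D {..<z}"
    by (simp add: emeasure_singleton)
  with le have eq: "emeasure D {..<z} = ennreal t"
    by simp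
  then have "F z = t"
    using t by (simp add: emeasure_lessThan)
  then have "{x. F x < t} = {..<z}"
    using below F_mono[of z] by (force simp: not_le[symmetric])
  with eq show ?thesis
    by simp
qed

end

section \<open>Finite diffuse measures and their scales\<close>

locale finite_diffuse_half_line = diffuse_half_line + finite_measure D
begin

lemma F_le: "F x \<le> measure D UNIV"
  unfolding F_def by (intro finite_measure_mono) auto

text \<open>In contrast to \<open>emeasure_F_less\<close> this includes the full mass, which
  \<open>F\<close> may approach without attaining; that case is a limit of smaller levels.\<close>

lemma measure_F_less:
  assumes "0 \<le> t" "t \<le> measure D UNIV"
  shows "measure D {x. F x < t} = t"
proof -
  have *: "measure D {x. F x < s} = s" if "0 \<le> s" "s < measure D UNIV" for s
    using emeasure_F_less[of s] that
    by (simp add: emeasure_eq_measure ennreal_less_iff)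
  show ?thesis
  proof (cases "t = measure D UNIV \<and> 0 < t")
    case True
    have "measure D {x. F x < t} \<ge> s" if "0 \<le> s" "s < t" for s
      using *[of s] True that finite_measure_mono[of "{x. F x < s}" "{x. F x < t}"] by force
    then have "t \<le> measure D {x. F x < t}"
      using True by (intro dense_ge_bounded[of 0 t] dense_le_bounded[of 0 t]) auto
    moreover have "measure D {x. F x < t} \<le> t"
      using True by (auto intro!: finite_measure_mono)
    ultimately show ?thesis
      by simp
  next
    case False
    then show ?thesis
      using * assms by (cases "t = 0") (auto simp: not_less)
  qed
qed

text \<open>Flat pieces of \<open>F\<close> have no mass: below the total mass,
  \<open>{F = y}\<close> fits between \<open>{F < y}\<close> and \<open>{F < s}\<close>, hence has
  mass at most \<open>s - y\<close>, and \<open>s\<close> may tend to \<open>y\<close>.\<close>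

lemma measure_F_eq: "measure D {x. F x = y} = 0"
proof -
  consider "y < 0" | "0 \<le> y" "y < measure D UNIV" | "measure D UNIV \<le> y"
    by linarith
  then show ?thesis
  proof cases
    case 1
    then have "{x. F x = y} = {}"
      using F_nonneg by (auto simp: not_less[symmetric])
    then show ?thesis by simp
  next
    case 2
    have "measure D {x. F x = y} \<le> s - y" if s: "y < s" "s < measure D UNIV" for s
    proof -
      have "measure D ({x. F x = y} \<union> {x. F x < y}) \<le> measure D {x. F x < s}"
        using s by (intro finite_measure_mono) auto
      also have "measure D ({x. F x = y} \<union> {x. F x < y}) = measure D {x. F x = y} + measure D {x. F x < y}"
        by (rule finite_measure_Union) auto
      finally show ?thesis
        using measure_F_less 2 s by simp
    qed
    then have "measure D {x. F x = y} + y \<le> y"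
      using 2(2) by (intro dense_ge_bounded[of y "measure D UNIV"]) (auto simp: algebra_simps)
    then show ?thesis
      using measure_nonneg[of D "{x. F x = y}"] by linarith
  next
    case 3
    have "measure D {x. F x = y} \<le> measure D (UNIV - {x. F x < measure D UNIV})"
      using 3 by (intro finite_measure_mono) auto
    also have "\<dots> = 0"
      using finite_measure_compl[of "{x. F x < measure D UNIV}"] measure_F_less[of "measure D UNIV"] by simp
    finally show ?thesis
      using measure_nonneg[of D "{x. F x = y}"] by linarith
  qed
qed

lemma emeasure_F_top: "emeasure D {x. measure D UNIV \<le> F x} = 0"
proof -
  have "{x. measure D UNIV \<le> F x} = {x. F x = measure D UNIV}"
    using F_le by (auto intro: antisym)
  then show ?thesis
    using measure_F_eq by (simp add: emeasure_eq_measure)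
qed

text \<open>The scale depends on \<open>D\<close> only through its total mass, so that two measures of equal
  mass are aligned by it. It tends to infinity only at the right end of the mass of \<open>D\<close>, which
  keeps its sublevel sets bounded up to a null set.\<close>

lemma ex_scale:
  "\<exists>r\<in>borel_measurable borel. (\<forall>x. 0 \<le> r x) \<and>
     (\<forall>z>0. measure D {x. r x < z} = measure D UNIV * z / (1 + z)) \<and>
     (\<forall>z. emeasure D {x. r x = z} = 0) \<and>
     (\<forall>z. \<exists>w. \<exists>E\<in>null_sets D. {x. r x < z} \<subseteq> {..<w} \<union> E)"
proof -
  define c where "c = measure D UNIV"
  have c: "0 \<le> c"
    by (simp add: c_def)
  \<comment> \<open>For positive \<open>c\<close>, the map \<open>v / (c - v)\<close> takes [0, c)
    increasingly onto [0, infinity), and \<open>y\<close> below is its inverse. The default 0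
    concerns only the null set where \<open>F\<close> reaches \<open>c\<close>.\<close>
  define r where "r x = (if F x < c then F x / (c - F x) else 0)" for x
  have r_meas [measurable]: "r \<in> borel_measurable borel"
    unfolding r_def by measurable
  have top [simp]: "{x. c \<le> F x} \<in> null_sets D"
    using emeasure_F_top by (auto simp: null_sets_def c_def)
  define y where "y z = c * z / (1 + z)" for z
  have y_le: "0 \<le> y z" "y z \<le> c" if "0 < z" for z
    using that c by (auto simp: y_def divide_simps algebra_simps)
  have r_less: "r x < z \<longleftrightarrow> F x < y z" if "0 < z" "F x < c" for x z
    using that by (auto simp: r_def y_def divide_simps algebra_simps)
  have r_less_Un: "{x. r x < z} = {x. F x < y z} \<union> {x. c \<le> F x}" if "0 < z" for z
    using r_less[OF that] y_le[OF that] that by (force simp: r_def not_less)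
  show ?thesis
  proof (intro bexI[of _ r] conjI allI impI)
    show "0 \<le> r x" for x
      by (simp add: r_def)
    show "measure D {x. r x < z} = measure D UNIV * z / (1 + z)" if "0 < z" for z
    proof -
      have "measure D {x. r x < z} = measure D {x. F x < y z}"
        unfolding r_less_Un[OF that] by (rule measure_Un_null_set) auto
      then show ?thesis
        using measure_F_less[of "y z"] y_le[OF that] by (simp add: c_def y_def)
    qed
    show "emeasure D {x. r x = z} = 0" for z
    proof -
      have "{x. r x = z} \<subseteq> {x. F x = y z} \<union> {x. c \<le> F x}"
      proof clarsimp
        fix x assume x: "z = r x" "\<not> c \<le> F x"
        moreover have "0 \<le> r x"
          by (simp add: r_def)
        ultimately show "F x = y (r x)"
          by (auto simp: y_def r_def divide_simps)
      qed
      moreover have "{x. F x = y z} \<union> {x. c \<le> F x} \<in> null_sets D"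
        using measure_F_eq by (intro null_sets.Un top) (auto simp: null_sets_def emeasure_eq_measure)
      ultimately show ?thesis
        using emeasure_eq_0[of "{x. F x = y z} \<union> {x. c \<le> F x}"] by (auto simp: null_sets_def)
    qed
    show "\<exists>w. \<exists>E\<in>null_sets D. {x. r x < z} \<subseteq> {..<w} \<union> E" for z
    \<comment> \<open>A level \<open>y z\<close> strictly below the total mass is reached by
      \<open>F\<close> at some \<open>w\<close>; in the remaining case the sublevel set is
      null.\<close>
    proof (cases "0 < z \<and> 0 < c")
      case True
      then have "y z < c"
        by (auto simp: y_def divide_simps algebra_simps)
      then obtain w where w: "y z \<le> F w"
        using F_unbounded[of "y z"] y_le[of z] True
        by (auto simp: emeasure_eq_measure ennreal_less_iff c_def)
      have "{x. F x < y z} \<subseteq> {..<w}"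
        using w F_mono[of w] by (force simp: not_le[symmetric])
      then show ?thesis
        unfolding r_less_Un[OF True[THEN conjunct1]]
        by (intro exI[of _ w] bexI[of _ "{x. c \<le> F x}"]) auto
    next
      case False
      have r_nonneg: "0 \<le> r x" for x
        by (simp add: r_def)
      have "{x. r x < z} \<subseteq> {x. c \<le> F x}"
      proof (cases "0 < z")
        case True
        with False c have "y z = 0"
          by (simp add: y_def)
        then show ?thesis
          unfolding r_less_Un[OF True] by (auto simp: not_less)
      next
        case False
        then have "\<not> r x < z" for x
          using r_nonneg[of x] by linarith
        then show ?thesis
          by simp
      qed
      then show ?thesis
        by (intro exI[of _ 0] bexI[of _ "{x. c \<le> F x}"]) auto
    qed
  qed simp
qed

end

section \<open>Densities and the map balancing their positive and negative parts\<close>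

lemma density_null_set_imp_positive_part_null:
  assumes "f \<in> borel_measurable M" "A \<in> sets M" "emeasure (density M (\<lambda>x. ennreal (f x))) A = 0"
  shows "A \<inter> {x \<in> space M. 0 < f x} \<in> null_sets M"
proof -
  have [measurable]: "f \<in> borel_measurable M" "A \<in> sets M"
    using assms by auto
  have "A \<in> null_sets (density M (\<lambda>x. ennreal (f x)))"
    using assms by (auto simp: null_sets_def)
  then have "AE x in M. x \<in> A \<longrightarrow> ennreal (f x) = 0"
    by (subst (asm) null_sets_density_iff) auto
  then have "AE x in M. x \<notin> A \<inter> {x \<in> space M. 0 < f x}"
    by eventually_elim (auto simp: ennreal_eq_0_iff)
  then show ?thesis
    by (subst AE_iff_null_sets) auto
qed

text \<open>\<open>ennreal\<close> truncates at zero, so the density is the positive part of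
  \<open>f\<close>. Integrability makes the measure finite, and absolute continuity passes on the
  null sets of \<open>N\<close>.\<close>

lemma finite_diffuse_half_line_density:
  assumes "diffuse_half_line N" "integrable N f"
  shows "finite_diffuse_half_line (density N (\<lambda>x. ennreal (f x)))"
    (is "finite_diffuse_half_line ?D")
proof -
  interpret N: diffuse_half_line N by fact
  have [measurable]: "f \<in> borel_measurable N"
    using assms by auto
  have "emeasure ?D (space ?D) \<noteq> \<infinity>"
    using assms(2) by (auto simp: emeasure_density real_integrable_def cong: nn_integral_cong)
  then interpret finite_measure ?D
    by (rule finite_measureI)
  have *: "emeasure ?D A = 0" if "emeasure N A = 0" "A \<in> sets borel" for A
    using that absolutely_continuousI_density[of "\<lambda>x. ennreal (f x)" N]
    by (auto simp: absolutely_continuous_def null_sets_def)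
  show ?thesis
  proof
    show "emeasure ?D {..<z} < \<infinity>" for z
      by (simp add: less_top[symmetric])
  qed (auto intro!: * N.emeasure_singleton N.emeasure_negative)
qed

text \<open>The Jordan decomposition of the signed measure with density \<open>f\<close>; truncation
  by \<open>ennreal\<close> produces the two parts.\<close>

lemma set_integral_eq_measure_density_diff:
  fixes f :: "'a \<Rightarrow> real"
  assumes "integrable M f" "A \<in> sets M"
  shows "(LINT x:A|M. f x) =
    measure (density M (\<lambda>x. ennreal (f x))) A - measure (density M (\<lambda>x. ennreal (- f x))) A"
proof -
  have [measurable]: "f \<in> borel_measurable M" "A \<in> sets M"
    using assms by auto
  have "(LINT x:A|M. f x) = enn2real (\<integral>\<^sup>+x. ennreal (indicator A x * f x) \<partial>M) -
      enn2real (\<integral>\<^sup>+x. ennreal (- (indicator A x * f x)) \<partial>M)"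
    unfolding set_lebesgue_integral_def real_scaleR_def
    using assms integrable_mult_indicator[of A M f] by (intro real_lebesgue_integral_def) auto
  also have "(\<integral>\<^sup>+x. ennreal (indicator A x * f x) \<partial>M) = emeasure (density M (\<lambda>x. ennreal (f x))) A"
    by (subst emeasure_density) (auto intro!: nn_integral_cong split: split_indicator)
  also have "(\<integral>\<^sup>+x. ennreal (- (indicator A x * f x)) \<partial>M) = emeasure (density M (\<lambda>x. ennreal (- f x))) A"
    by (subst emeasure_density) (auto intro!: nn_integral_cong split: split_indicator)
  finally show ?thesis
    by (simp add: measure_def)
qed

context diffuse_half_line
begin

text \<open>Both parts of \<open>g\<close> have mass \<open>c\<close>, so their scales
  \<open>p\<close> and \<open>q\<close> have the same profile \<open>c * z / (1 + z)\<close>, and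
  the contributions of the two parts to \<open>{r < z}\<close> cancel.\<close>

lemma ex_balanced_rearrangement:
  fixes g :: "real \<Rightarrow> real"
  assumes g: "integrable D g" "(LINT x|D. g x) = 0"
  shows "\<exists>r\<in>borel_measurable borel. diffuse_half_line (distr D borel r) \<and>
    (\<forall>z. (LINT x:{x. r x < z}|D. g x) = 0)"
proof -
  have g_meas [measurable]: "g \<in> borel_measurable borel"
    using g(1) by (metis borel_measurable_integrable measurable_cong_sets sets_eq_borel)
  define P where "P = density D (\<lambda>x. ennreal (g x))"
  define Q where "Q = density D (\<lambda>x. ennreal (- g x))"
  interpret P: finite_diffuse_half_line P
    unfolding P_def using g by (intro finite_diffuse_half_line_density diffuse_half_line_axioms) auto
  interpret Q: finite_diffuse_half_line Q
    unfolding Q_def using g by (intro finite_diffuse_half_line_density diffuse_half_line_axioms) auto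
  define c where "c = measure P UNIV"
  have "measure P UNIV = measure Q UNIV"
    using set_integral_eq_measure_density_diff[OF g(1), of UNIV] g(2)
    by (simp add: P_def Q_def set_lebesgue_integral_def)
  then have c: "measure P UNIV = c" "measure Q UNIV = c"
    by (simp_all add: c_def)
  obtain p where p [measurable]: "p \<in> borel_measurable borel" and p_nonneg: "\<And>x. 0 \<le> p x"
    and p_less: "\<And>z. 0 < z \<Longrightarrow> measure P {x. p x < z} = c * z / (1 + z)"
    and p_eq: "\<And>z. emeasure P {x. p x = z} = 0"
    and p_bdd: "\<And>z. \<exists>w. \<exists>E\<in>null_sets P. {x. p x < z} \<subseteq> {..<w} \<union> E"
    using P.ex_scale unfolding c by blast
  obtain q where q [measurable]: "q \<in> borel_measurable borel" and q_nonneg: "\<And>x. 0 \<le> q x"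
    and q_less: "\<And>z. 0 < z \<Longrightarrow> measure Q {x. q x < z} = c * z / (1 + z)"
    and q_eq: "\<And>z. emeasure Q {x. q x = z} = 0"
    and q_bdd: "\<And>z. \<exists>w. \<exists>E\<in>null_sets Q. {x. q x < z} \<subseteq> {..<w} \<union> E"
    using Q.ex_scale unfolding c by blast
  \<comment> \<open>This and \<open>Q_null\<close> carry the exceptional sets of the scales back to
    \<open>D\<close>.\<close>
  have P_null: "A \<inter> {x. 0 < g x} \<in> null_sets D" if "emeasure P A = 0" "A \<in> sets borel" for A
    using density_null_set_imp_positive_part_null[of g D A] that by (simp add: P_def)
  have Q_null: "A \<inter> {x. g x < 0} \<in> null_sets D" if "emeasure Q A = 0" "A \<in> sets borel" for A
    using density_null_set_imp_positive_part_null[of "\<lambda>x. - g x" D A] that by (simp add: Q_def)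
  \<comment> \<open>On \<open>{g = 0}\<close> balance imposes nothing; \<open>max 0 x\<close> keeps
    \<open>r\<close> nonnegative and creates neither atoms nor sublevel sets of infinite
    mass.\<close>
  define r where "r x = (if 0 < g x then p x else if g x < 0 then q x else max 0 x)" for x
  have r [measurable]: "r \<in> borel_measurable borel"
    unfolding r_def by measurable
  have r_nonneg: "0 \<le> r x" for x
    using p_nonneg q_nonneg by (simp add: r_def)
  have measure_P: "measure P {x. r x < z} = measure P {x. p x < z}" for z
    unfolding measure_def P_def
    by (subst (1 2) emeasure_density)
      (auto intro!: arg_cong[where f = enn2real] nn_integral_cong simp: r_def ennreal_neg split: split_indicator)
  have measure_Q: "measure Q {x. r x < z} = measure Q {x. q x < z}" for z
    unfolding measure_def Q_def
    by (subst (1 2) emeasure_density)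
      (auto intro!: arg_cong[where f = enn2real] nn_integral_cong simp: r_def ennreal_neg split: split_indicator)
  have finite: "emeasure D {x. r x < z} < \<infinity>" for z
  proof -
    obtain w E where E: "E \<in> null_sets P" "{x. p x < z} \<subseteq> {..<w} \<union> E"
      using p_bdd by blast
    obtain w' E' where E': "E' \<in> null_sets Q" "{x. q x < z} \<subseteq> {..<w'} \<union> E'"
      using q_bdd by blast
    have null: "E \<inter> {x. 0 < g x} \<union> E' \<inter> {x. g x < 0} \<in> null_sets D"
      using E(1) E'(1) by (intro null_sets.Un P_null Q_null) (auto simp: null_sets_def)
    \<comment> \<open>Up to a null set, the three pieces of \<open>{r < z}\<close> are bounded above
      by \<open>w\<close>, \<open>w'\<close> and \<open>z\<close>.\<close>
    let ?A = "{..<max z (max w w')} \<union> (E \<inter> {x. 0 < g x} \<union> E' \<inter> {x. g x < 0})"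
    have "emeasure D {x. r x < z} \<le> emeasure D ?A"
      using E(2) E'(2) null by (intro emeasure_mono) (auto simp: r_def split: if_splits)
    also have "\<dots> = emeasure D {..<max z (max w w')}"
      using null by (intro emeasure_Un_null_set) auto
    also have "\<dots> < \<infinity>"
      by (rule emeasure_lessThan_finite)
    finally show ?thesis .
  qed
  have diffuse: "emeasure D {x. r x = z} = 0" for z
  proof -
    \<comment> \<open>The half-line \<open>{..<0}\<close> covers the points that
      \<open>max 0 x\<close> collapses to 0.\<close>
    let ?A = "{x. p x = z} \<inter> {x. 0 < g x} \<union> {x. q x = z} \<inter> {x. g x < 0} \<union> ({..<0} \<union> {0} \<union> {z})"
    have "{x. r x = z} \<subseteq> ?A"
      by (auto simp: r_def max_def split: if_splits)
    moreover have "?A \<in> null_sets D"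
      using p_eq q_eq emeasure_negative emeasure_singleton
      by (intro null_sets.Un P_null Q_null) (auto simp: null_sets_def)
    ultimately show ?thesis
      by (auto intro: emeasure_eq_0)
  qed
  have balanced: "(LINT x:{x. r x < z}|D. g x) = 0" for z
  proof (cases "0 < z")
    case True
    then show ?thesis
      using set_integral_eq_measure_density_diff[OF g(1), of "{x. r x < z}"] p_less q_less
      by (simp add: P_def[symmetric] Q_def[symmetric] measure_P measure_Q)
  next
    case False
    then have "\<not> r x < z" for x
      using r_nonneg[of x] by linarith
    then show ?thesis
      by (simp add: set_lebesgue_integral_def)
  qed
  have "diffuse_half_line (distr D borel r)"
  proof
    show "emeasure (distr D borel r) {z} = 0" for z
      using diffuse[of z] by (simp add: emeasure_distr vimage_def)
    show "emeasure (distr D borel r) {..<z} < \<infinity>" for z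
      using finite[of z] by (simp add: emeasure_distr vimage_def)
    show "emeasure (distr D borel r) {..<0} = 0"
      using r_nonneg by (simp add: emeasure_distr vimage_def not_less[THEN iffD2])
  qed simp
  then show ?thesis
    using balanced r by blast
qed

lemma sigma_finite: "sigma_finite_measure D"
proof
  show "\<exists>A. countable A \<and> A \<subseteq> sets D \<and> \<Union>A = space D \<and> (\<forall>a\<in>A. emeasure D a \<noteq> \<infinity>)"
    using emeasure_lessThan_finite reals_Archimedean2
    by (intro exI[of _ "range (\<lambda>n. {..<real n})"]) (auto simp: less_top[symmetric])
qed

end

section \<open>One coordinate for finitely many functions\<close>

text \<open>\<open>h\<close> is the conditional expectation of \<open>g\<close> given
  \<open>\<tau>\<close>, as a function of the value of \<open>\<tau>\<close>: a Radon-Nikodym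
  derivative of the image of the measure with density \<open>g\<close>.\<close>

lemma ex_pushforward_density_nonneg:
  fixes g :: "'a \<Rightarrow> real" and \<tau> :: "'a \<Rightarrow> real"
  assumes [measurable]: "\<tau> \<in> borel_measurable M"
    and N: "sigma_finite_measure (distr M borel \<tau>)"
    and g: "integrable M g" "\<And>x. x \<in> space M \<Longrightarrow> 0 \<le> g x"
  shows "\<exists>h. integrable (distr M borel \<tau>) h \<and>
    (\<forall>B\<in>sets borel. (LINT x:B|distr M borel \<tau>. h x) = (LINT x:\<tau> -` B \<inter> space M|M. g x))"
proof -
  let ?N = "distr M borel \<tau>"
  interpret N: sigma_finite_measure ?N by fact
  have [measurable]: "g \<in> borel_measurable M"
    using g by auto
  define D where "D = distr (density M (\<lambda>x. ennreal (g x))) borel \<tau>"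
  have D: "emeasure D B = ennreal (LINT x:\<tau> -` B \<inter> space M|M. g x)" if [measurable]: "B \<in> sets borel" for B
  proof -
    have "emeasure D B = (\<integral>\<^sup>+x. ennreal (g x) * indicator (\<tau> -` B \<inter> space M) x \<partial>M)"
      by (simp add: D_def emeasure_distr emeasure_density)
    also have "\<dots> = (\<integral>\<^sup>+x. ennreal (indicator (\<tau> -` B \<inter> space M) x *\<^sub>R g x) \<partial>M)"
      by (auto intro!: nn_integral_cong split: split_indicator)
    also have "\<dots> = ennreal (LINT x|M. indicator (\<tau> -` B \<inter> space M) x *\<^sub>R g x)"
      using g by (intro nn_integral_eq_integral integrable_mult_indicator AE_I2) (auto split: split_indicator)
    finally show ?thesis
      by (simp add: set_lebesgue_integral_def)
  qed
  have "absolutely_continuous ?N D"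
    unfolding absolutely_continuous_def
  proof
    fix B assume "B \<in> null_sets ?N"
    then have B: "B \<in> sets borel" "\<tau> -` B \<inter> space M \<in> null_sets M"
      by (auto simp: null_sets_def emeasure_distr)
    then have "(LINT x:\<tau> -` B \<inter> space M|M. g x) = 0"
      unfolding set_lebesgue_integral_def
      by (intro integral_eq_zero_AE) (auto dest!: AE_not_in simp: indicator_def)
    then show "B \<in> null_sets D"
      using B D by (auto simp: null_sets_def D_def)
  qed
  then obtain k where [measurable]: "k \<in> borel_measurable ?N" and k: "density ?N k = D"
    using N.Radon_Nikodym[of D] by (auto simp: D_def)
  have k_int: "(\<integral>\<^sup>+x. k x * indicator B x \<partial>?N) = ennreal (LINT x:\<tau> -` B \<inter> space M|M. g x)"
    if "B \<in> sets borel" for B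
    using D[OF that] that unfolding k[symmetric] by (simp add: emeasure_density)
  have "(\<integral>\<^sup>+x. k x \<partial>?N) \<noteq> \<infinity>"
    using k_int[of UNIV] by simp
  \<comment> \<open>Being finite almost everywhere, \<open>k\<close> keeps its integrals when
    \<open>enn2real\<close> makes it real-valued.\<close>
  then have fin: "AE x in ?N. k x \<noteq> \<infinity>"
    by (intro nn_integral_PInf_AE) auto
  have h_int: "(\<integral>\<^sup>+x. ennreal (indicator B x *\<^sub>R enn2real (k x)) \<partial>?N) = ennreal (LINT x:\<tau> -` B \<inter> space M|M. g x)"
    if "B \<in> sets borel" for B
    unfolding k_int[OF that, symmetric]
    using fin by (intro nn_integral_cong_AE) (auto split: split_indicator simp: less_top)
  show ?thesis
  proof (intro exI[of _ "\<lambda>x. enn2real (k x)"] conjI ballI)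
    show "integrable ?N (\<lambda>x. enn2real (k x))"
      using h_int[of UNIV] by (intro integrableI_nonneg) auto
    fix B :: "real set" assume [measurable]: "B \<in> sets borel"
    have "0 \<le> (LINT x:\<tau> -` B \<inter> space M|M. g x)"
      unfolding set_lebesgue_integral_def using g(2)
      by (intro Bochner_Integration.integral_nonneg) (auto split: split_indicator)
    then show "(LINT x:B|?N. enn2real (k x)) = (LINT x:\<tau> -` B \<inter> space M|M. g x)"
      unfolding set_lebesgue_integral_def[of ?N]
      by (subst integral_eq_nn_integral) (auto simp: h_int simp del: real_scaleR_def intro!: AE_I2 scaleR_nonneg_nonneg)
  qed
qed

lemma ex_pushforward_density:
  fixes g :: "'a \<Rightarrow> real" and \<tau> :: "'a \<Rightarrow> real"
  assumes [measurable]: "\<tau> \<in> borel_measurable M"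
    and N: "sigma_finite_measure (distr M borel \<tau>)"
    and g: "integrable M g"
  shows "\<exists>h. integrable (distr M borel \<tau>) h \<and>
    (\<forall>B\<in>sets borel. (LINT x:B|distr M borel \<tau>. h x) = (LINT x:\<tau> -` B \<inter> space M|M. g x))"
proof -
  let ?N = "distr M borel \<tau>"
  have g': "integrable M (\<lambda>x. max 0 (g x))" "integrable M (\<lambda>x. max 0 (- g x))"
    using g by (auto intro: integrable_max)
  obtain h1 where h1: "integrable ?N h1"
    "\<And>B. B \<in> sets borel \<Longrightarrow> (LINT x:B|?N. h1 x) = (LINT x:\<tau> -` B \<inter> space M|M. max 0 (g x))"
    using ex_pushforward_density_nonneg[OF assms(1) N g'(1)] by auto
  obtain h2 where h2: "integrable ?N h2"
    "\<And>B. B \<in> sets borel \<Longrightarrow> (LINT x:B|?N. h2 x) = (LINT x:\<tau> -` B \<inter> space M|M. max 0 (- g x))"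
    using ex_pushforward_density_nonneg[OF assms(1) N g'(2)] by auto
  show ?thesis
  proof (intro exI[of _ "\<lambda>x. h1 x - h2 x"] conjI ballI)
    show "integrable ?N (\<lambda>x. h1 x - h2 x)"
      using h1 h2 by simp
    fix B :: "real set" assume B [measurable]: "B \<in> sets borel"
    have "(LINT x:B|?N. h1 x - h2 x) = (LINT x:B|?N. h1 x) - (LINT x:B|?N. h2 x)"
      using h1 h2
      by (intro set_integral_diff) (auto simp: set_integrable_def simp del: real_scaleR_def intro!: integrable_mult_indicator)
    also have "\<dots> = (LINT x:\<tau> -` B \<inter> space M|M. max 0 (g x) - max 0 (- g x))"
      unfolding h1(2)[OF B] h2(2)[OF B] using g'
      by (intro set_integral_diff(2)[symmetric])
        (auto simp: set_integrable_def simp del: real_scaleR_def intro!: integrable_mult_indicator)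
    also have "(\<lambda>x. max 0 (g x) - max 0 (- g x)) = g"
      by (auto simp: max_def)
    finally show "(LINT x:B|?N. h1 x - h2 x) = (LINT x:\<tau> -` B \<inter> space M|M. g x)" .
  qed
qed

text \<open>A pi-lambda argument from half-lines to Borel sets. Complements use that the whole
  integral is 0, disjoint unions use countable additivity.\<close>

lemma set_integral_vimage_eq_0:
  fixes g :: "'a \<Rightarrow> real" and \<tau> :: "'a \<Rightarrow> real"
  assumes [measurable]: "\<tau> \<in> borel_measurable M"
    and g: "integrable M g" "(LINT x|M. g x) = 0"
    and less: "\<And>z. (LINT x:\<tau> -` {..<z} \<inter> space M|M. g x) = 0"
    and "B \<in> sets borel"
  shows "(LINT x:\<tau> -` B \<inter> space M|M. g x) = 0"
proof -
  have int: "set_integrable M A g" if "A \<in> sets M" for A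
    unfolding set_integrable_def using g that by (intro integrable_mult_indicator)
  have sp: "(LINT x:space M|M. g x) = 0"
    using g(2) by (simp add: set_integral_space g(1))
  have sigma: "B \<in> sigma_sets UNIV (range lessThan)"
    using \<open>B \<in> sets borel\<close> by (simp add: borel_Iio)
  have "{..<a} \<inter> {..<b} = {..<min a b}" for a b :: real
    by auto
  then have stable: "Int_stable (range (lessThan :: real \<Rightarrow> _))"
    by (auto simp: Int_stable_def)
  have "range (lessThan :: real \<Rightarrow> _) \<subseteq> Pow UNIV"
    by simp
  from stable this sigma show ?thesis
  proof (induction rule: sigma_sets_induct_disjoint)
    case (basic A)
    then show ?case
      using less by auto
  next
    case empty
    then show ?case
      by (simp add: set_lebesgue_integral_def)
  next
    case (compl A)
    then have [measurable]: "A \<in> sets borel"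
      by (simp add: borel_Iio)
    have "(LINT x:\<tau> -` (UNIV - A) \<inter> space M|M. g x) + (LINT x:\<tau> -` A \<inter> space M|M. g x) =
      (LINT x:(\<tau> -` (UNIV - A) \<inter> space M) \<union> (\<tau> -` A \<inter> space M)|M. g x)"
      by (intro set_integral_Un[symmetric] int) auto
    also have "(\<tau> -` (UNIV - A) \<inter> space M) \<union> (\<tau> -` A \<inter> space M) = space M"
      by auto
    finally show ?case
      using compl sp by simp
  next
    case (union A)
    then have [measurable]: "A i \<in> sets borel" for i
      by (auto simp: borel_Iio)
    have "(LINT x:(\<Union>i. \<tau> -` A i \<inter> space M)|M. g x) = (\<Sum>i. LINT x:\<tau> -` A i \<inter> space M|M. g x)"
      using union(1) by (intro lebesgue_integral_countable_add int) (auto simp: disjoint_family_on_def)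
    moreover have "\<tau> -` (\<Union>i. A i) \<inter> space M = (\<Union>i. \<tau> -` A i \<inter> space M)"
      by auto
    ultimately show ?case
      using union by simp
  qed
qed

text \<open>Quantifying over all Borel \<open>B\<close> makes the induction work: preimages under
  \<open>r \<circ> \<sigma>\<close> are preimages of Borel sets under \<open>\<sigma>\<close>, so
  earlier functions stay balanced.\<close>

lemma ex_common_coordinate:
  fixes \<tau> :: "'a \<Rightarrow> real"
  assumes "finite S"
    and "\<tau> \<in> borel_measurable M" "diffuse_half_line (distr M borel \<tau>)"
    and "\<And>g. g \<in> S \<Longrightarrow> integrable M g" "\<And>g. g \<in> S \<Longrightarrow> (LINT x|M. g x) = 0"
  shows "\<exists>\<sigma>\<in>borel_measurable M. diffuse_half_line (distr M borel \<sigma>) \<and>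
    (\<forall>g\<in>S. \<forall>B\<in>sets borel. (LINT x:\<sigma> -` B \<inter> space M|M. g x) = (0::real))"
  using assms(1,4,5)
proof (induction S rule: finite_induct)
  case empty
  then show ?case
    using assms(2,3) by auto
next
  case (insert g S)
  obtain \<sigma> where \<sigma> [measurable]: "\<sigma> \<in> borel_measurable M" and diff: "diffuse_half_line (distr M borel \<sigma>)"
    and S: "\<And>g B. g \<in> S \<Longrightarrow> B \<in> sets borel \<Longrightarrow> (LINT x:\<sigma> -` B \<inter> space M|M. g x) = 0"
    using insert.IH insert.prems by auto
  interpret diffuse_half_line "distr M borel \<sigma>" by fact
  have g: "integrable M g" "(LINT x|M. g x) = 0"
    using insert.prems by auto
  obtain h where h: "integrable (distr M borel \<sigma>) h"
    and h_eq: "\<And>B. B \<in> sets borel \<Longrightarrow> (LINT x:B|distr M borel \<sigma>. h x) = (LINT x:\<sigma> -` B \<inter> space M|M. g x)"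
    using ex_pushforward_density[OF \<sigma> sigma_finite g(1)] by blast
  have "(LINT x|distr M borel \<sigma>. h x) = 0"
    using h_eq[of UNIV] g by (simp add: set_integral_space) (simp add: set_lebesgue_integral_def)
  then obtain r where r [measurable]: "r \<in> borel_measurable borel"
    and r_diff: "diffuse_half_line (distr (distr M borel \<sigma>) borel r)"
    and r_less: "\<And>z. (LINT x:{x. r x < z}|distr M borel \<sigma>. h x) = 0"
    using ex_balanced_rearrangement[OF h] by blast
  show ?case
  proof (intro bexI[of _ "r \<circ> \<sigma>"] conjI ballI)
    show "diffuse_half_line (distr M borel (r \<circ> \<sigma>))"
      using r_diff by (simp add: distr_distr)
    fix f and B :: "real set" assume f: "f \<in> insert g S" and B [measurable]: "B \<in> sets borel"
    show "(LINT x:(r \<circ> \<sigma>) -` B \<inter> space M|M. f x) = 0"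
    proof (cases "f = g")
      case True
      \<comment> \<open>Balance on the line is pulled back to X through \<open>h_eq\<close>, first
        for half-lines.\<close>
      have "(LINT x:(r \<circ> \<sigma>) -` {..<z} \<inter> space M|M. g x) = 0" for z
        using r_less[of z] h_eq[of "{x. r x < z}"] by (simp add: vimage_def)
      from set_integral_vimage_eq_0[OF _ g this B] show ?thesis
        using True by simp
    next
      case False
      then have "f \<in> S"
        using f by simp
      then show ?thesis
        using S[of f "r -` B"] measurable_sets[OF r B] by (simp add: vimage_comp)
    qed
  qed simp
qed

section \<open>Diffuse functions on nonatomic spaces\<close>

text \<open>Digits 0 and 1 in base 3 avoid the ambiguity of binary expansions: at the first
  difference \<open>m\<close> the terms differ by \<open>(1 / 3) ^ m\<close>, and all later terms
  compensate at most half of that.\<close>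

lemma ternary_expansion_unique:
  fixes d e :: "nat \<Rightarrow> bool"
  assumes "(\<Sum>n. of_bool (d n) * (1 / 3) ^ n :: real) = (\<Sum>n. of_bool (e n) * (1 / 3) ^ n)"
  shows "d = e"
proof (rule ccontr)
  assume "d \<noteq> e"
  then have ex: "\<exists>n. d n \<noteq> e n"
    by auto
  define m where "m = (LEAST n. d n \<noteq> e n)"
  have m: "d m \<noteq> e m"
    unfolding m_def using ex by (rule LeastI_ex)
  have less: "d n = e n" if "n < m" for n
    using not_less_Least[of n "\<lambda>n. d n \<noteq> e n"] that by (auto simp: m_def)
  have sum: "summable (\<lambda>n. of_bool (b n) * (1 / 3) ^ n :: real)" for b
    by (rule summable_comparison_test[OF _ summable_geometric[of "1 / 3 :: real"]]) auto
  define a :: "nat \<Rightarrow> real" where "a n = (of_bool (d n) - of_bool (e n)) * (1 / 3) ^ n" for n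
  have a_sum: "summable a"
    using summable_diff[OF sum[of d] sum[of e]] by (simp add: a_def[abs_def] left_diff_distrib)
  have "(\<Sum>n. a n) = 0"
    using suminf_diff[OF sum[of d] sum[of e]] assms by (simp add: a_def left_diff_distrib)
  then have "(\<Sum>n. a (n + Suc m)) = - (\<Sum>n<Suc m. a n)"
    using suminf_split_initial_segment[OF a_sum, of "Suc m"] by simp
  also have "(\<Sum>n<Suc m. a n) = a m"
    using less by (simp add: a_def)
  finally have "\<bar>\<Sum>n. a (n + Suc m)\<bar> = (1 / 3) ^ m"
    using m by (auto simp: a_def)
  moreover have "norm (\<Sum>n. a (n + Suc m)) \<le> (\<Sum>n. (1 / 3) ^ Suc m * (1 / 3) ^ n)"
    by (intro norm_suminf_le summable_mult summable_geometric) (auto simp: a_def power_add)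
  moreover have "(\<Sum>n. (1 / 3) ^ Suc m * (1 / 3) ^ n :: real) = (1 / 3) ^ m / 2"
    by (subst suminf_mult) (auto simp: suminf_geometric)
  moreover have "(0::real) < (1 / 3) ^ m"
    by simp
  ultimately show False
    unfolding real_norm_def by linarith
qed

text \<open>The factor 2 replaces attainment of the supremum; this weak maximality still bounds the
  size of each split from below.\<close>

lemma (in finite_measure) ex_almost_maximal_half:
  assumes A: "A \<in> sets M"
  shows "\<exists>B\<in>sets M. B \<subseteq> A \<and> measure M B \<le> measure M A / 2 \<and>
    (\<forall>C\<in>sets M. C \<subseteq> A \<and> measure M C \<le> measure M A / 2 \<longrightarrow> measure M C \<le> 2 * measure M B)"
proof -
  define K where "K = {C \<in> sets M. C \<subseteq> A \<and> measure M C \<le> measure M A / 2}"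
  define s where "s = (SUP C\<in>K. measure M C)"
  have bdd: "bdd_above (measure M ` K)"
    by (rule bdd_aboveI2[of _ _ "measure M A / 2"]) (simp add: K_def)
  have le: "measure M C \<le> s" if "C \<in> K" for C
    unfolding s_def using that bdd by (rule cSUP_upper)
  have empty: "{} \<in> K"
    by (simp add: K_def)
  obtain B where "B \<in> K" "s \<le> 2 * measure M B"
  proof (cases "s \<le> 0")
    case True
    then show ?thesis
      using that[of "{}"] empty by simp
  next
    case False
    then have "s / 2 < (SUP C\<in>K. measure M C)"
      by (simp add: s_def)
    then obtain B where "B \<in> K" "s / 2 < measure M B"
      using empty less_cSUP_iff[of K "measure M" "s / 2"] bdd by auto
    then show ?thesis
      using that[of B] by simp
  qed
  then show ?thesis
    using le by (intro bexI[of _ B]) (force simp: K_def)+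
qed

text \<open>For \<open>x\<close> in \<open>X\<close>, the cell at depth \<open>n\<close> containing
  \<open>x\<close> in the binary splitting tree where a cell \<open>A\<close> has the children
  \<open>h A\<close> and \<open>A - h A\<close>.\<close>

primrec branch :: "('a set \<Rightarrow> 'a set) \<Rightarrow> 'a set \<Rightarrow> 'a \<Rightarrow> nat \<Rightarrow> 'a set" where
  "branch h X x 0 = X"
| "branch h X x (Suc n) =
    (if x \<in> h (branch h X x n) then h (branch h X x n) else branch h X x n - h (branch h X x n))"

lemma mem_branch: "x \<in> X \<Longrightarrow> x \<in> branch h X x n"
  by (induction n) auto

text \<open>Cells of equal depth coincide once they meet. The family \<open>\<A>\<close> will be the
  sigma-algebra.\<close>

lemma branch_eq:
  assumes "\<And>A. A \<in> \<A> \<Longrightarrow> h A \<in> \<A> \<and> A - h A \<in> \<A> \<and> h A \<subseteq> A" "X \<in> \<A>"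
  shows "branch h X x n \<in> \<A>" "y \<in> branch h X x n \<Longrightarrow> branch h X y n = branch h X x n"
proof -
  show *: "branch h X x n \<in> \<A>" for n
    using assms by (induction n) auto
  show "branch h X y n = branch h X x n" if "y \<in> branch h X x n"
    using that
  proof (induction n)
    case (Suc n)
    then have "y \<in> branch h X x n"
      using assms(1)[OF *[of n]] by (auto split: if_splits)
    with Suc show ?case
      by (auto split: if_splits)
  qed simp
qed

text \<open>Makes the digits measurable: each digit set is a finite union over cells.\<close>

lemma finite_branches: "finite (range (\<lambda>x. branch h X x n))"
proof (induction n)
  case (Suc n)
  let ?B = "range (\<lambda>x. branch h X x n)"
  have "range (\<lambda>x. branch h X x (Suc n)) \<subseteq> h ` ?B \<union> (\<lambda>A. A - h A) ` ?B"
    by auto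
  then show ?case
    using Suc by (meson finite_UnI finite_imageI finite_subset)
qed simp

text \<open>The digit sequence of a point records the branch of the splitting tree containing it. A
  set of positive measure cannot lie in all members of one branch: one of its subsets would
  remain a competitor for every split, so each split would remove a fixed amount of measure.\<close>

lemma (in finite_measure) ex_diffuse_function:
  assumes split: "\<And>A. A \<in> sets M \<Longrightarrow> 0 < measure M A \<Longrightarrow>
      \<exists>B\<in>sets M. B \<subseteq> A \<and> 0 < measure M B \<and> measure M B < measure M A"
  shows "\<exists>\<tau>\<in>borel_measurable M. (\<forall>x. 0 \<le> \<tau> x) \<and>
    (\<forall>z::real. measure M {x \<in> space M. \<tau> x = z} = 0)"
proof -
  have "\<forall>A\<in>sets M. \<exists>B. B \<in> sets M \<and> B \<subseteq> A \<and> measure M B \<le> measure M A / 2 \<and>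
    (\<forall>C\<in>sets M. C \<subseteq> A \<and> measure M C \<le> measure M A / 2 \<longrightarrow> measure M C \<le> 2 * measure M B)"
  proof
    fix A assume "A \<in> sets M"
    from ex_almost_maximal_half[OF this] show "\<exists>B. B \<in> sets M \<and> B \<subseteq> A \<and> measure M B \<le> measure M A / 2 \<and>
        (\<forall>C\<in>sets M. C \<subseteq> A \<and> measure M C \<le> measure M A / 2 \<longrightarrow> measure M C \<le> 2 * measure M B)"
      unfolding Bex_def .
  qed
  from bchoice[OF this] obtain h where "\<forall>A\<in>sets M. h A \<in> sets M \<and> h A \<subseteq> A \<and> measure M (h A) \<le> measure M A / 2 \<and>
    (\<forall>C\<in>sets M. C \<subseteq> A \<and> measure M C \<le> measure M A / 2 \<longrightarrow> measure M C \<le> 2 * measure M (h A))" ..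
  then have h: "\<And>A. A \<in> sets M \<Longrightarrow> h A \<in> sets M" "\<And>A. A \<in> sets M \<Longrightarrow> h A \<subseteq> A"
    and half: "\<And>A. A \<in> sets M \<Longrightarrow> measure M (h A) \<le> measure M A / 2"
    and max: "\<And>A C. A \<in> sets M \<Longrightarrow> C \<in> sets M \<Longrightarrow> C \<subseteq> A \<Longrightarrow>
      measure M C \<le> measure M A / 2 \<Longrightarrow> measure M C \<le> 2 * measure M (h A)"
    by simp_all
  define p where "p = branch h (space M)"
  have p_sets [simp, measurable]: "p x n \<in> sets M" for x n
    unfolding p_def by (rule branch_eq(1)) (use h in auto)
  have p_eq: "p y n = p x n" if "y \<in> p x n" for x y n
    using that unfolding p_def by (rule branch_eq(2)[of "sets M", rotated 2]) (use h in auto)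
  have mem_p: "x \<in> p x n" if "x \<in> space M" for x n
    using mem_branch[OF that] by (simp add: p_def)
  have p_Suc: "p x (Suc n) = (if x \<in> h (p x n) then h (p x n) else p x n - h (p x n))" for x n
    by (simp add: p_def)
  define d where "d x n \<longleftrightarrow> x \<in> h (p x n)" for x n
  have "{x \<in> space M. d x n} = (\<Union>A\<in>range (\<lambda>x. p x n). h A)" for n
  proof (intro set_eqI iffI)
    fix y assume "y \<in> (\<Union>A\<in>range (\<lambda>x. p x n). h A)"
    then obtain x where y: "y \<in> h (p x n)"
      by auto
    then have "y \<in> p x n" "y \<in> space M"
      using h(2)[OF p_sets, of x n] sets.sets_into_space[OF h(1)[OF p_sets, of x n]] by blast+
    with y show "y \<in> {x \<in> space M. d x n}"
      using p_eq[of y x n] by (simp add: d_def)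
  qed (auto simp: d_def)
  moreover have "(\<Union>A\<in>range (\<lambda>x. p x n). h A) \<in> sets M" for n
  proof (rule sets.finite_UN)
    show "finite (range (\<lambda>x. p x n))"
      unfolding p_def by (rule finite_branches)
  qed (auto intro: h(1))
  ultimately have d_sets [measurable]: "Measurable.pred M (\<lambda>x. d x n)" for n
    by (simp add: pred_def)
  define \<tau> :: "'a \<Rightarrow> real" where "\<tau> x = (\<Sum>n. of_bool (d x n) * (1 / 3) ^ n)" for x
  have \<tau> [measurable]: "\<tau> \<in> borel_measurable M"
    unfolding \<tau>_def by measurable
  have \<tau>_nonneg: "0 \<le> \<tau> x" for x
    unfolding \<tau>_def
    by (intro suminf_nonneg summable_comparison_test[OF _ summable_geometric[of "1 / 3 :: real"]]) auto
  have "measure M {x \<in> space M. \<tau> x = z} = 0" for z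
  proof (rule ccontr)
    define T where "T = {x \<in> space M. \<tau> x = z}"
    have [measurable]: "T \<in> sets M"
      unfolding T_def by measurable
    assume "measure M {x \<in> space M. \<tau> x = z} \<noteq> 0"
    then have "0 < measure M T"
      by (simp add: T_def zero_less_measure_iff)
    then obtain B where B: "B \<in> sets M" "B \<subseteq> T" "0 < measure M B" "measure M B < measure M T"
      using split[of T] by auto
    \<comment> \<open>Both \<open>B\<close> and \<open>T - B\<close> have positive measure, and one
      of them has at most half of that of \<open>T\<close>.\<close>
    obtain C where C: "C \<in> sets M" "C \<subseteq> T" "0 < measure M C" "measure M C \<le> measure M T / 2"
    proof (cases "measure M B \<le> measure M T / 2")
      case True
      then show ?thesis
        using that[of B] B by simp
    next
      case False
      then show ?thesis
        using that[of "T - B"] B finite_measure_Diff[of T B] by auto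
    qed
    obtain x where x: "x \<in> T"
      using B by fastforce
    have "p y n = p x n" if "y \<in> T" for y n
    proof -
      have "d y = d x"
        using that x by (intro ternary_expansion_unique) (auto simp: T_def \<tau>_def)
      then have digit: "y \<in> h (p y k) \<longleftrightarrow> x \<in> h (p x k)" for k
        by (simp add: d_def fun_eq_iff)
      show ?thesis
      proof (induction n)
        case (Suc n)
        then show ?case
          using digit[of n] by (simp add: p_Suc)
      qed (simp add: p_def)
    qed
    then have T_subset: "T \<subseteq> p x n" for n
      using mem_p[of _ n] by (force simp: T_def)
    \<comment> \<open>The cell contains \<open>T\<close>, so \<open>C\<close> competes in its split.
      Hence \<open>h (p x n)\<close> has at least half the measure of \<open>C\<close> and at most
      half that of the cell: passing to either child loses at least half the measure of
      \<open>C\<close>.\<close>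
    have decr_step: "measure M (p x (Suc n)) \<le> measure M (p x n) - measure M C / 2" for n
    proof -
      have "measure M T \<le> measure M (p x n)"
        using T_subset by (intro finite_measure_mono) auto
      then have le: "measure M C \<le> measure M (p x n) / 2"
        using C by simp
      then have "measure M C \<le> 2 * measure M (h (p x n))"
        using C T_subset[of n] by (intro max) auto
      then show ?thesis
        using le half[OF p_sets, of x n] C(3) h[OF p_sets, of x n]
        by (auto simp: p_Suc finite_measure_Diff)
    qed
    have decr: "measure M (p x n) \<le> measure M (p x 0) - n * (measure M C / 2)" for n
    proof (induction n)
      case (Suc n)
      then show ?case
        using decr_step[of n] by (simp add: algebra_simps add_divide_distrib)
    qed simp
    obtain n :: nat where "measure M (p x 0) < n * (measure M C / 2)"
      using reals_Archimedean3[of "measure M C / 2"] C(3) by auto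
    then show False
      using decr[of n] measure_nonneg[of M "p x n"] by linarith
  qed
  with \<tau> \<tau>_nonneg show ?thesis
    by blast
qed

text \<open>Positivity of \<open>k\<close> gives both measures the same null sets, so it suffices
  that \<open>B\<close> and \<open>A - B\<close> are not null for \<open>M\<close>, even if
  \<open>A\<close> has infinite measure.\<close>

lemma nonatomic_split_finite_density:
  assumes M: "nonatomic M" "sigma_finite_measure M"
    and [measurable]: "k \<in> borel_measurable M" and k: "\<And>x. x \<in> space M \<Longrightarrow> 0 < k x"
    and "finite_measure (density M k)"
    and A: "A \<in> sets M" "0 < measure (density M k) A"
  shows "\<exists>B\<in>sets M. B \<subseteq> A \<and> 0 < measure (density M k) B \<and> measure (density M k) B < measure (density M k) A"
proof -
  let ?D = "density M k"
  interpret D: finite_measure ?D by fact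
  have null: "measure ?D C = 0 \<longleftrightarrow> emeasure M C = 0" if "C \<in> sets M" for C
  proof -
    have "measure ?D C = 0 \<longleftrightarrow> C \<in> null_sets ?D"
      using that by (simp add: null_sets_def D.emeasure_eq_measure)
    also have "\<dots> \<longleftrightarrow> (AE x in M. x \<notin> C)"
      using that by (subst null_sets_density_iff) (auto intro!: AE_cong dest: k simp: less_le)
    also have "\<dots> \<longleftrightarrow> emeasure M C = 0"
      using that by (subst AE_iff_null_sets[symmetric]) (auto simp: null_sets_def)
    finally show ?thesis .
  qed
  have "0 < emeasure M A"
    using null[OF A(1)] A(2) by (simp add: zero_less_iff_neq_zero)
  then obtain B where B: "B \<in> sets M" "B \<subseteq> A" "0 < emeasure M B" "emeasure M B < emeasure M A"
    using M(1) A(1) unfolding nonatomic_def by blast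
  have "emeasure M B + emeasure M (A - B) = emeasure M A"
    using B A plus_emeasure[of B M "A - B"] by (simp add: Un_absorb1)
  then have "emeasure M (A - B) \<noteq> 0"
    using B(4) by auto
  then have "measure ?D (A - B) \<noteq> 0" "measure ?D B \<noteq> 0"
    using null[of "A - B"] null[of B] A B by auto
  then have "0 < measure ?D (A - B)" "0 < measure ?D B"
    by (simp_all add: zero_less_measure_iff)
  moreover have "measure ?D (A - B) = measure ?D A - measure ?D B"
    using D.finite_measure_Diff[of A B] A B by simp
  ultimately show ?thesis
    using B by (intro bexI[of _ B]) auto
qed

text \<open>A diffuse function for an equivalent finite measure is also diffuse for
  \<open>M\<close>; adding the index of an exhaustion by sets of finite measure makes its sublevel
  sets finite.\<close>

lemma nonatomic_imp_ex_diffuse_coordinate: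
  assumes "sigma_finite_measure M" "nonatomic M"
  shows "\<exists>\<tau>\<in>borel_measurable M. diffuse_half_line (distr M borel \<tau>)"
proof -
  interpret sigma_finite_measure M by fact
  obtain k where k [measurable]: "k \<in> borel_measurable M" and k_int: "integral\<^sup>N M k \<noteq> \<infinity>"
    and k_pos: "\<And>x. x \<in> space M \<Longrightarrow> 0 < k x"
    using Ex_finite_integrable_function by blast
  let ?D = "density M k"
  interpret D: finite_measure ?D
    using k_int by (intro finite_measureI) (simp add: emeasure_density cong: nn_integral_cong)
  obtain \<tau> :: "'a \<Rightarrow> real" where \<tau> [measurable]: "\<tau> \<in> borel_measurable M" and \<tau>_nonneg: "\<And>x. 0 \<le> \<tau> x"
    and \<tau>_eq: "\<And>z. measure ?D {x \<in> space M. \<tau> x = z} = 0"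
    using D.ex_diffuse_function
      nonatomic_split_finite_density[OF assms(2,1) k k_pos D.finite_measure_axioms] by auto
  have \<tau>_null: "{x \<in> space M. \<tau> x = z} \<in> null_sets M" for z
  proof -
    have "{x \<in> space M. \<tau> x = z} \<in> null_sets ?D"
      using \<tau>_eq[of z] by (auto simp: null_sets_def D.emeasure_eq_measure)
    then have "AE x in M. x \<in> {x \<in> space M. \<tau> x = z} \<longrightarrow> k x = 0"
      by (subst (asm) null_sets_density_iff) auto
    with AE_space have "AE x in M. x \<notin> {x \<in> space M. \<tau> x = z}"
      by eventually_elim (use k_pos in force)
    then show ?thesis
      by (subst AE_iff_null_sets) auto
  qed
  obtain A :: "nat \<Rightarrow> 'a set" where A: "range A \<subseteq> sets M" "(\<Union>i. A i) = space M"
    "\<And>i. emeasure M (A i) \<noteq> \<infinity>" "incseq A"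
    using sigma_finite_incseq by blast
  have [measurable]: "A i \<in> sets M" for i
    using A(1) by auto
  define j where "j x = (LEAST i. x \<in> A i)" for x
  have [measurable]: "j \<in> measurable M (count_space UNIV)"
    unfolding j_def by measurable
  have mem: "x \<in> A (j x)" if "x \<in> space M" for x
  proof -
    have "\<exists>i. x \<in> A i"
      using that A(2) by blast
    then show ?thesis
      unfolding j_def by (rule LeastI_ex)
  qed
  define \<sigma> where "\<sigma> x = real (j x) + \<tau> x" for x
  have \<sigma> [measurable]: "\<sigma> \<in> borel_measurable M"
    unfolding \<sigma>_def by measurable
  have "diffuse_half_line (distr M borel \<sigma>)"
  proof
    fix z
    \<comment> \<open>The index takes countably many values, so level sets remain null.\<close>
    have "{x \<in> space M. \<sigma> x = z} \<subseteq> (\<Union>i. {x \<in> space M. \<tau> x = z - real i})"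
      by (auto simp: \<sigma>_def)
    moreover have "(\<Union>i. {x \<in> space M. \<tau> x = z - real i}) \<in> null_sets M"
      using \<tau>_null by (intro null_sets_UN) auto
    ultimately have "emeasure M {x \<in> space M. \<sigma> x = z} = 0"
      by (auto intro: emeasure_eq_0)
    then show "emeasure (distr M borel \<sigma>) {z} = 0"
      by (simp add: emeasure_distr vimage_def Int_def conj_commute)
    have "\<sigma> -` {..<z} \<inter> space M \<subseteq> A (nat \<lceil>z\<rceil>)"
    proof
      fix x assume "x \<in> \<sigma> -` {..<z} \<inter> space M"
      then have x: "x \<in> space M" "\<sigma> x < z"
        by auto
      then have "real (j x) < z"
        using \<tau>_nonneg[of x] by (simp add: \<sigma>_def)
      then have "j x \<le> nat \<lceil>z\<rceil>"
        by linarith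
      then show "x \<in> A (nat \<lceil>z\<rceil>)"
        using mem[OF x(1)] A(4) by (auto simp: incseq_def)
    qed
    then have "emeasure M (\<sigma> -` {..<z} \<inter> space M) \<le> emeasure M (A (nat \<lceil>z\<rceil>))"
      by (rule emeasure_mono) simp
    also have "\<dots> < \<infinity>"
      using A(3) by (simp add: less_top[symmetric])
    finally show "emeasure (distr M borel \<sigma>) {..<z} < \<infinity>"
      by (simp add: emeasure_distr)
    have "\<not> \<sigma> x < 0" for x
      using \<tau>_nonneg[of x] by (simp add: \<sigma>_def not_less)
    then have "\<sigma> -` {..<0} \<inter> space M = {}"
      by auto
    then show "emeasure (distr M borel \<sigma>) {..<0} = 0"
      by (simp add: emeasure_distr)
  qed simp
  with \<sigma> show ?thesis
    by blast
qed

section \<open>The common segment\<close>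

theorem theorem0p3:
  fixes M :: "'a measure" and S :: "('a \<Rightarrow> real) set"
  assumes "sigma_finite_measure M"
    and "emeasure M (space M) = \<infinity>"
    and "nonatomic M"
    and "finite S"
    and "\<And>f. f \<in> S \<Longrightarrow> f \<in> borel_measurable M"
    and "\<And>f. f \<in> S \<Longrightarrow> integrable M (\<lambda>x. f x - 1)"
    and "\<And>f. f \<in> S \<Longrightarrow> (LINT x|M. (f x - 1)) = 0"
  shows "\<exists>u. common_segment M S u"
proof -
  obtain \<tau> :: "'a \<Rightarrow> real" where "\<tau> \<in> borel_measurable M" "diffuse_half_line (distr M borel \<tau>)"
    using nonatomic_imp_ex_diffuse_coordinate assms(1,3) by blast
  then have "\<exists>\<sigma>\<in>borel_measurable M. diffuse_half_line (distr M borel \<sigma>) \<and>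
    (\<forall>g\<in>(\<lambda>f x. f x - 1) ` S. \<forall>B\<in>sets borel. (LINT x:\<sigma> -` B \<inter> space M|M. g x) = 0)"
    using assms(4,6,7) by (intro ex_common_coordinate) auto
  then obtain \<sigma> where \<sigma> [measurable]: "\<sigma> \<in> borel_measurable M" and diff: "diffuse_half_line (distr M borel \<sigma>)"
    and \<sigma>_0: "\<And>f B. f \<in> S \<Longrightarrow> B \<in> sets borel \<Longrightarrow> (LINT x:\<sigma> -` B \<inter> space M|M. f x - 1) = 0"
    by auto
  interpret diffuse_half_line "distr M borel \<sigma>" by fact
  \<comment> \<open>Strict inequality gives \<open>u 0 = {}\<close>, because \<open>F\<close> is
    nonnegative.\<close>
  define u where "u t = \<sigma> -` {x. F x < t} \<inter> space M" for t
  have u [measurable]: "u t \<in> sets M" for t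
    unfolding u_def by measurable
  \<comment> \<open>Infinite total measure makes every finite level admissible.\<close>
  have emeasure_u: "emeasure M (u t) = ennreal t" if "0 \<le> t" for t
    using emeasure_F_less[OF that] assms(2) by (simp add: emeasure_distr u_def)
  have "common_segment M S u"
    unfolding common_segment_def
  proof (intro conjI allI ballI impI)
    show "u 0 = {}"
      by (simp add: u_def)
    show "u s \<subseteq> u t" if "0 \<le> s \<and> s < t" for s t
      using that by (auto simp: u_def)
    show "(\<Union>t\<in>{0..}. u t) = space M"
    proof (intro equalityI subsetI)
      fix x assume "x \<in> space M"
      then show "x \<in> (\<Union>t\<in>{0..}. u t)"
        by (intro UN_I[of "F (\<sigma> x) + 1"]) (auto simp: u_def)
    qed (auto simp: u_def)
    fix f and t :: real assume f: "f \<in> S" and t: "0 \<le> t"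
    \<comment> \<open>Split \<open>f\<close> as \<open>(f - 1) + 1\<close>: on \<open>u t\<close>
      the first summand has integral 0 and the second has integral \<open>t\<close>.\<close>
    have one: "set_integrable M (u t) (\<lambda>_. 1 :: real)"
      using emeasure_u[OF t] by (simp add: set_integrable_def)
    have f1: "set_integrable M (u t) (\<lambda>x. f x - 1)"
      unfolding set_integrable_def using assms(6)[OF f] u by (intro integrable_mult_indicator)
    show "set_integrable M (u t) f"
      using set_integral_add(1)[OF f1 one] by simp
    have "(LINT x:u t|M. f x) = (LINT x:u t|M. f x - 1) + (LINT x:u t|M. 1)"
      using set_integral_add(2)[OF f1 one] by simp
    also have "(LINT x:u t|M. f x - 1) = 0"
      unfolding u_def by (rule \<sigma>_0[OF f]) simp
    also have "(LINT x:u t|M. 1) = t"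
      using emeasure_u[OF t] t by (simp add: set_lebesgue_integral_def measure_def)
    finally show "(LINT x:u t|M. f x) = t"
      by simp
  qed simp
  then show ?thesis
    by blast
qed

end
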